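(* Let $p_1<p_2$ be finite real numbers, let $f$ be a symbol with $f''>0$ as in the context, and let $u_0\in\mathcal S(\mathbb R)$ satisfy $\mathrm{supp}\,\mathcal F u_0\subseteq[p_1,p_2]$ and $\|u_0\|_{L^2(\mathbb R)}=1$. Let $(t_0,x_0)\in\mathbb R^2$. Then for all $t\in\mathbb R\setminus\{t_0\}$, we have $$\mathcal M_1\big(u_f(t,\cdot)\big)=\mathcal M_1\big(H_f(t,\cdot,u_0,t_0,x_0)\big)\quad\Longleftrightarrow\quad x_0=\mathcal M_1\big(u_f(t_0,\cdot)\big).$$
   Context: Fourier transform: $\mathcal F u(p)=\int_{\mathbb R}u(x)e^{-ixp}\,dx$. The symbol $f:\mathbb R\to\mathbb R$ is $\mathcal C^\infty$, all its derivatives grow at most polynomially at infinity, and $f''>0$ on $\mathbb R$. The wave packet is $u_f(t,x)=\frac1{2\pi}\int_{\mathbb R}\mathcal F u_0(p)\,e^{-itf(p)+ixp}\,dp$. For $t\neq t_0$ and $x\in\mathbb R$, with $p_0(t,x):=(f')^{-1}\big(\frac{x-x_0}{t-t_0}\big)$, $$H_f(t,x,u_0,t_0,x_0):=\frac1{\sqrt{2\pi}}\,e^{-\mathrm{sgn}(t-t_0)i\frac\pi4}\,e^{-itf(p_0(t,x))+ixp_0(t,x)}\,\frac{\mathcal F u_0(p_0(t,x))}{\sqrt{f''(p_0(t,x))}}\,|t-t_0|^{-\frac12};$$ this function is supported in $\{(t,x):f'(p_1)\leqslant\frac{x-x_0}{t-t_0}\leqslant f'(p_2)\}$ and is understood to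 be $0$ where $\frac{x-x_0}{t-t_0}\notin f'(\mathbb R)$. For $u$ with $\|u\|_{L^2(\mathbb R)}=1$: $\mathcal M_1(u)=\int_{\mathbb R}x\,|u(x)|^2\,dx$. *)

theory Defs
  imports "HOL-Analysis.Analysis" "HOL-Library.Landau_Symbols"
begin

definition fourier_transform :: "(real \<Rightarrow> complex) \<Rightarrow> real \<Rightarrow> complex" where
  "fourier_transform u p = (LBINT x. u x * exp (- \<i> * of_real (x * p)))"

abbreviation higher_vderiv :: "nat \<Rightarrow> (real \<Rightarrow> 'a::real_normed_vector) \<Rightarrow> real \<Rightarrow> 'a" where
  "higher_vderiv n g \<equiv> ((\<lambda>h x. vector_derivative h (at x)) ^^ n) g"

definition smooth :: "(real \<Rightarrow> 'a::real_normed_vector) \<Rightarrow> bool" where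
  "smooth g \<longleftrightarrow> (\<forall>n x. higher_vderiv n g differentiable (at x))"

definition schwartz :: "(real \<Rightarrow> complex) \<Rightarrow> bool" where
  "schwartz u \<longleftrightarrow> smooth u \<and>
     (\<forall>m n. bounded (range (\<lambda>x. of_real (x ^ m) * higher_vderiv n u x)))"

definition support :: "(real \<Rightarrow> complex) \<Rightarrow> real set" where
  "support g = closure {x. g x \<noteq> 0}"

definition is_symbol :: "(real \<Rightarrow> real) \<Rightarrow> bool" where
  "is_symbol f \<longleftrightarrow> smooth f \<and>
     (\<forall>n. \<exists>N::nat. higher_vderiv n f \<in> O[at_infinity](\<lambda>x. x ^ N))"

definition L2_norm :: "(real \<Rightarrow> complex) \<Rightarrow> real" where
  "L2_norm u = sqrt (LBINT x. (cmod (u x))\<^sup>2)"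

text \<open>
  The first moment; it is meant for functions with \<open>L2_norm u = 1\<close>, so there is no
  normalising factor.
\<close>

definition mean_position :: "(real \<Rightarrow> complex) \<Rightarrow> real" where
  "mean_position u = (LBINT x. x * (cmod (u x))\<^sup>2)"

definition wave_packet ::
  "(real \<Rightarrow> real) \<Rightarrow> (real \<Rightarrow> complex) \<Rightarrow> real \<Rightarrow> real \<Rightarrow> complex" where
  "wave_packet f u0 t x =
     of_real (1 / (2 * pi)) *
     (LBINT p. fourier_transform u0 p *
        exp (- \<i> * of_real (t * f p) + \<i> * of_real (x * p)))"

definition stationary_point ::
  "(real \<Rightarrow> real) \<Rightarrow> real \<Rightarrow> real \<Rightarrow> real \<Rightarrow> real \<Rightarrow> real" where
  "stationary_point f t0 x0 t x = inv (deriv f) ((x - x0) / (t - t0))"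

text \<open>
  Outside the cone \<open>(x - x0) / (t - t0) \<in> range (deriv f)\<close> the stationary point does not
  exist; \<open>H_profile\<close> is zero there by convention. Meant for \<open>t \<noteq> t0\<close> only.
\<close>

definition H_profile ::
  "(real \<Rightarrow> real) \<Rightarrow> real \<Rightarrow> real \<Rightarrow> (real \<Rightarrow> complex) \<Rightarrow> real \<Rightarrow> real \<Rightarrow> complex" where
  "H_profile f t x u0 t0 x0 =
     (if (x - x0) / (t - t0) \<in> range (deriv f) then
        let p0 = stationary_point f t0 x0 t x in
          of_real (1 / sqrt (2 * pi)) *
          exp (- of_real (sgn (t - t0)) * \<i> * of_real (pi / 4)) *
          exp (- \<i> * of_real (t * f p0) + \<i> * of_real (x * p0)) *
          (fourier_transform u0 p0 / of_real (sqrt (deriv (deriv f) p0))) *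
          of_real (\<bar>t - t0\<bar> powr (- (1 / 2)))
      else 0)"

end

theory Submission
  imports Defs "HOL-Probability.Probability"
begin

text \<open>
  Let \<open>g\<close> be the Fourier transform of the initial state. The velocity of the frequency \<open>p\<close> is
  \<open>f' p\<close>, and the mean velocity is \<open>V = (1 / 2\<pi>) \<integral> f' \<bar>g\<bar>\<^sup>2\<close>.

  The mean position of the wave packet moves with this constant velocity: multiplication by \<open>x\<close>
  becomes \<open>\<i> d/dp\<close> on the Fourier side, and the derivative of the phase \<open>exp (- \<i> t f)\<close> contributes
  exactly \<open>t V\<close> (lemma \<open>mean_position_wave_packet\<close>). In the profile, all frequencies start from the
  one point \<open>x0\<close> at time \<open>t0\<close> and \<open>p\<close> travels along the ray \<open>x0 + (t - t0) f' p\<close>; the density of the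
  profile is the image of \<open>\<bar>g\<bar>\<^sup>2 / (2\<pi>)\<close> along these rays, and this has total mass 1. Its mean position is
  therefore \<open>x0 + (t - t0) V\<close> (lemma \<open>mean_position_H_profile\<close>). Both motions are uniform with the same
  velocity, so the two means agree at one time \<open>t\<close> exactly when they start together at \<open>t0\<close>.

  The analytic content is Plancherel's identity (\<open>plancherel\<close>), proved by Gaussian regularisation. It
  is used twice: for the normalisation \<open>(1 / 2\<pi>) \<integral> \<bar>g\<bar>\<^sup>2 = 1\<close>, and in polarised form for the first
  moment of a Fourier transform (\<open>first_moment_fourier_transform\<close>). The decay of the
  initial state makes \<open>x u0\<close> integrable, and hence \<open>g\<close> continuously differentiable.
\<close>

section \<open>The Fourier transform of integrable functions\<close>

lemma norm_phase [simp]: "cmod (exp (- (\<i> * complex_of_real y))) = 1"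
  by (simp add: norm_exp_eq_Re)

lemma norm_phase_mult [simp]: "cmod (exp (- (\<i> * (complex_of_real x * complex_of_real p)))) = 1"
  using norm_phase[of "x * p"] by simp

lemma borel_measurable_cnj [measurable]: "cnj \<in> borel_measurable borel"
  by (intro borel_measurable_continuous_onI continuous_intros)

lemma integrable_mult_bounded:
  fixes f g :: "real \<Rightarrow> complex"
  assumes f: "integrable lborel f" and g[measurable]: "g \<in> borel_measurable borel"
    and bound: "\<And>x. cmod (g x) \<le> B"
  shows "integrable lborel (\<lambda>x. f x * g x)"
proof (rule Bochner_Integration.integrable_bound)
  show "integrable lborel (\<lambda>x. B * cmod (f x))"
    using f by (intro integrable_mult_right integrable_norm)
  have [measurable]: "f \<in> borel_measurable borel"
    using borel_measurable_integrable[OF f] by simp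
  show "(\<lambda>x. f x * g x) \<in> borel_measurable lborel"
    by simp
  have "0 \<le> B"
    using bound[of 0] norm_ge_zero order_trans by blast
  then show "AE x in lborel. norm (f x * g x) \<le> norm (B * cmod (f x))"
    using bound by (auto simp: norm_mult abs_mult mult.commute[of "cmod (f _)"] intro!: mult_right_mono)
qed

lemma integrable_phase:
  assumes "integrable lborel w"
  shows "integrable lborel (\<lambda>x. w x * exp (- \<i> * of_real (x * p)))"
proof (rule integrable_mult_bounded[OF assms, where B = 1])
  show "(\<lambda>x. exp (- \<i> * of_real (x * p))) \<in> borel_measurable borel"
    by (intro borel_measurable_continuous_onI continuous_intros)
qed simp

lemma borel_measurable_fourier_transform:
  assumes "integrable lborel w"
  shows "fourier_transform w \<in> borel_measurable borel"
proof -
  have [measurable]: "w \<in> borel_measurable borel"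
    using borel_measurable_integrable[OF assms] by simp
  have [measurable]: "(\<lambda>(p, x). exp (- \<i> * of_real (x * p)) :: complex)
      \<in> borel_measurable (borel \<Otimes>\<^sub>M lborel)"
    by (simp add: case_prod_beta' borel_measurable_continuous_onI
        continuous_intros flip: borel_prod)
  have "(\<lambda>p. LBINT x. w x * exp (- \<i> * of_real (x * p))) \<in> borel_measurable borel"
    by (rule lborel.borel_measurable_lebesgue_integral) measurable
  then show ?thesis
    unfolding fourier_transform_def .
qed

lemma norm_fourier_transform_le:
  "cmod (fourier_transform w p) \<le> (LBINT x. cmod (w x))"
proof -
  have "cmod (fourier_transform w p) \<le> (LBINT x. cmod (w x * exp (- \<i> * of_real (x * p))))"
    unfolding fourier_transform_def by (rule integral_norm_bound)
  then show ?thesis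
    by (simp add: norm_mult)
qed

text \<open>
  Fubini. The formula moves the Fourier transform from one factor to the other, so that a
  transform can be traded for the explicit transform of a Gaussian.
\<close>
lemma fourier_transform_multiplication:
  assumes w: "integrable lborel w" and h: "integrable lborel h"
  shows "(LBINT p. fourier_transform w p * h p) = (LBINT x. w x * fourier_transform h x)"
proof -
  have [measurable]: "w \<in> borel_measurable borel" "h \<in> borel_measurable borel"
    using w h borel_measurable_integrable by simp_all
  have [measurable]: "(\<lambda>(x, p). exp (- \<i> * of_real (x * p)) :: complex)
      \<in> borel_measurable (lborel \<Otimes>\<^sub>M lborel)"
    by (simp add: case_prod_beta' borel_measurable_continuous_onI
        continuous_intros flip: borel_prod)
  let ?F = "\<lambda>x p. w x * h p * exp (- \<i> * of_real (x * p))"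
  have int: "integrable (lborel \<Otimes>\<^sub>M lborel) (case_prod ?F)"
  proof (rule lborel_pair.Fubini_integrable)
    show "case_prod ?F \<in> borel_measurable (lborel \<Otimes>\<^sub>M lborel)"
      by measurable
    show "integrable lborel (\<lambda>x. LBINT y. norm (case (x, y) of (x, p) \<Rightarrow> ?F x p))"
      using w by (simp add: norm_mult)
    have "integrable lborel (\<lambda>p. w x * (h p * exp (- \<i> * of_real (p * x))))" for x
      by (intro integrable_mult_right integrable_phase h)
    then show "AE x in lborel. integrable lborel (\<lambda>y. case (x, y) of (x, p) \<Rightarrow> ?F x p)"
      by (simp add: mult_ac)
  qed
  have "(LBINT p. fourier_transform w p * h p) = (LBINT p. LBINT x. ?F x p)"
    unfolding fourier_transform_def
    by (rule Bochner_Integration.integral_cong)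
       (simp_all add: mult_ac flip: integral_mult_left_zero integral_mult_right_zero)
  also have "\<dots> = (LBINT x. LBINT p. ?F x p)"
    by (rule lborel_pair.Fubini_integral[OF int])
  also have "\<dots> = (LBINT x. w x * fourier_transform h x)"
    unfolding fourier_transform_def
    by (rule Bochner_Integration.integral_cong)
       (simp_all add: mult_ac flip: integral_mult_left_zero integral_mult_right_zero)
  finally show ?thesis .
qed

lemma integrable_gaussian:
  assumes "s > 0"
  shows "integrable lborel (\<lambda>p. complex_of_real (exp (- (s * p)\<^sup>2 / 2)))"
proof -
  have "integrable lborel (\<lambda>p. sqrt (2 * pi) * std_normal_density p)"
    using integrable_std_normal_moment[of 0] by simp
  then have "integrable lborel (\<lambda>p::real. exp (- p\<^sup>2 / 2))"
    by (simp add: std_normal_density_def)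
  from lborel_integrable_real_affine[OF this, of s 0] assms
  show ?thesis
    by (intro integrable_of_real) simp
qed

text \<open>
  Up to scaling this is the characteristic function of the standard normal distribution.
\<close>
lemma gaussian_phase_integral:
  assumes s: "s > 0"
  shows "(LBINT p. of_real (exp (- (s * p)\<^sup>2 / 2)) * exp (\<i> * of_real (q * p)))
    = complex_of_real (sqrt (2 * pi) / s * exp (- (q / s)\<^sup>2 / 2))"
proof -
  have "complex_of_real (exp (- (q / s)\<^sup>2 / 2)) = char std_normal_distribution (q / s)"
    by (simp add: char_std_normal_distribution)
  also have "\<dots> = (LBINT x. std_normal_density x *\<^sub>R exp (\<i> * of_real (q / s * x)))"
    unfolding char_def by (rule integral_density) auto
  also have "\<dots> = s *\<^sub>R (LBINT p. std_normal_density (s * p) *\<^sub>R exp (\<i> * of_real (q * p)))"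
    using s by (subst lborel_integral_real_affine[of s _ 0]) auto
  also have "(LBINT p. std_normal_density (s * p) *\<^sub>R exp (\<i> * of_real (q * p)))
      = (LBINT p. of_real (1 / sqrt (2 * pi)) *
          (of_real (exp (- (s * p)\<^sup>2 / 2)) * exp (\<i> * of_real (q * p))))"
    by (simp add: std_normal_density_def scaleR_conv_of_real)
  also have "\<dots> = of_real (1 / sqrt (2 * pi)) *
      (LBINT p. of_real (exp (- (s * p)\<^sup>2 / 2)) * exp (\<i> * of_real (q * p)))"
    by (rule integral_mult_right_zero)
  finally have "complex_of_real (exp (- (q / s)\<^sup>2 / 2)) = of_real (s / sqrt (2 * pi)) *
      (LBINT p. of_real (exp (- (s * p)\<^sup>2 / 2)) * exp (\<i> * of_real (q * p)))"
    by (simp add: scaleR_conv_of_real)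
  moreover have "sqrt (2 * pi) / s * (s / sqrt (2 * pi)) = 1"
    using s by simp
  ultimately show ?thesis
    by (simp only: of_real_mult) (simp only: of_real_1 mult.assoc[symmetric] mult_1 flip: of_real_mult)
qed

text \<open>
  Conjugation flips the sign of the phase, and the reflection of the argument flips it back. So the
  conjugate of a transform is again a transform, and the multiplication formula applies to it.
\<close>
lemma cnj_fourier_transform:
  "cnj (fourier_transform w p) = fourier_transform (\<lambda>y. cnj (w (- y))) p"
proof -
  have "cnj (fourier_transform w p) = (LBINT x. cnj (w x * exp (- \<i> * of_real (x * p))))"
    unfolding fourier_transform_def
    by (rule Bochner_Integration.integral_cnj[symmetric])
  also have "\<dots> = (LBINT x. cnj (w x) * exp (\<i> * of_real (x * p)))"
    by (simp add: exp_cnj)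
  also have "\<dots> = fourier_transform (\<lambda>y. cnj (w (- y))) p"
    unfolding fourier_transform_def
    by (subst lborel_integral_real_affine[of "-1" _ 0]) auto
  finally show ?thesis .
qed

text \<open>
  The identity behind Plancherel's theorem, with a Gaussian weight that makes every integral
  absolutely convergent. Two applications of the multiplication formula remove both transforms from
  the left-hand side and put the transform of the weight, a Gaussian of width \<open>s\<close>, in their place.
  The result pairs \<open>w\<close> with its average over a Gaussian neighbourhood of each point.
\<close>
lemma fourier_transform_gaussian_mean:
  assumes w: "integrable lborel w" and s: "s > 0"
  shows "(LBINT p. of_real (exp (- (s * p)\<^sup>2 / 2)) * (fourier_transform w p * cnj (fourier_transform w p)))
    = of_real (2 * pi) * (LBINT x. w x * (LBINT z. cnj (w (x + s * z)) * of_real (std_normal_density z)))"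
proof -
  let ?E = "\<lambda>p. complex_of_real (exp (- (s * p)\<^sup>2 / 2))"
  let ?v = "\<lambda>y. cnj (w (- y))"
  let ?h = "\<lambda>p. ?E p * cnj (fourier_transform w p)"
  have [measurable]: "w \<in> borel_measurable borel"
    using borel_measurable_integrable[OF w] by simp
  have E: "integrable lborel ?E"
    by (rule integrable_gaussian[OF s])
  have v: "integrable lborel ?v"
    using lborel_integrable_real_affine[OF w, of "-1" 0] by (simp add: integrable_cnj)
  have h: "integrable lborel ?h"
    by (rule integrable_mult_bounded[OF E, where B = "LBINT x. cmod (w x)"])
       (use w in \<open>auto simp: norm_fourier_transform_le intro: measurable_compose[OF borel_measurable_fourier_transform[OF w] borel_measurable_cnj]\<close>)
  have ft_h: "fourier_transform ?h x
      = of_real (2 * pi) * (LBINT z. cnj (w (x + s * z)) * of_real (std_normal_density z))" for x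
  proof -
    let ?k = "\<lambda>p. ?E p * exp (- \<i> * of_real (p * x))"
    have k: "integrable lborel ?k"
      by (rule integrable_phase[OF E])
    have ft_k: "fourier_transform ?k y = of_real (sqrt (2 * pi) / s * exp (- ((x + y) / s)\<^sup>2 / 2))" for y
    proof -
      have "fourier_transform ?k y = (LBINT p. ?E p * exp (\<i> * of_real (- (x + y) * p)))"
        unfolding fourier_transform_def mult.assoc exp_add[symmetric]
        by (simp add: algebra_simps)
      then show ?thesis
        unfolding gaussian_phase_integral[OF s] by (simp add: power2_eq_square field_simps)
    qed
    have "fourier_transform ?h x = (LBINT p. fourier_transform ?v p * ?k p)"
      unfolding fourier_transform_def[of ?h]
      by (simp add: cnj_fourier_transform mult_ac)
    also have "\<dots> = (LBINT y. ?v y * fourier_transform ?k y)"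
      by (rule fourier_transform_multiplication[OF v k])
    also have "\<dots> = s *\<^sub>R (LBINT z. ?v (- x + - s * z) * fourier_transform ?k (- x + - s * z))"
      using s by (subst lborel_integral_real_affine[of "-s" _ "-x"]) auto
    also have "(\<lambda>z. ?v (- x + - s * z) * fourier_transform ?k (- x + - s * z)) =
        (\<lambda>z. of_real (2 * pi / s) * (cnj (w (x + s * z)) * of_real (std_normal_density z)))"
    proof
      fix z
      have "sqrt (2 * pi) = 2 * pi * (1 / sqrt (2 * pi))"
        by (simp add: real_div_sqrt)
      then have "sqrt (2 * pi) / s * exp (- z\<^sup>2 / 2) = 2 * pi / s * std_normal_density z"
        unfolding std_normal_density_def by (metis (no_types) mult.assoc times_divide_eq_left)
      then have "fourier_transform ?k (- x + - s * z) = of_real (2 * pi / s * std_normal_density z)"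
        unfolding ft_k using s by simp
      then show "?v (- x + - s * z) * fourier_transform ?k (- x + - s * z) =
          of_real (2 * pi / s) * (cnj (w (x + s * z)) * of_real (std_normal_density z))"
        by (simp add: algebra_simps)
    qed
    finally show ?thesis
      using s by (simp add: scaleR_conv_of_real)
  qed
  have "(LBINT p. ?E p * (fourier_transform w p * cnj (fourier_transform w p))) = (LBINT p. fourier_transform w p * ?h p)"
    by (simp add: mult_ac)
  also have "\<dots> = (LBINT x. w x * fourier_transform ?h x)"
    by (rule fourier_transform_multiplication[OF w h])
  also have "\<dots> = (LBINT x. of_real (2 * pi) * (w x * (LBINT z. cnj (w (x + s * z)) * of_real (std_normal_density z))))"
    unfolding ft_h by (simp add: mult_ac)
  finally show ?thesis
    by simp
qed

section \<open>Plancherel's identity\<close>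

lemma std_normal_density_integrable: "integrable lborel std_normal_density"
  using integrable_std_normal_moment[of 0] by simp

lemma gaussian_mean_tendsto:
  fixes v :: "real \<Rightarrow> complex"
  assumes v: "continuous_on UNIV v" and bound: "\<And>x. cmod (v x) \<le> B"
    and s: "s \<longlonglongrightarrow> 0"
  shows "(\<lambda>n. LBINT z. v (x + s n * z) * of_real (std_normal_density z)) \<longlonglongrightarrow> v x"
proof -
  have [measurable]: "v \<in> borel_measurable borel"
    using v by (rule borel_measurable_continuous_onI)
  have cont: "isCont v y" for y
    using v by (simp add: continuous_on_eq_continuous_at)
  have "(\<lambda>n. LBINT z. v (x + s n * z) * of_real (std_normal_density z))
      \<longlonglongrightarrow> (LBINT z. v x * of_real (std_normal_density z))"
  proof (rule integral_dominated_convergence[where w = "\<lambda>z. B * std_normal_density z"])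
    show "AE z in lborel. (\<lambda>n. v (x + s n * z) * of_real (std_normal_density z))
        \<longlonglongrightarrow> v x * of_real (std_normal_density z)"
    proof (intro AE_I2 tendsto_mult tendsto_const)
      fix z
      have "(\<lambda>n. x + s n * z) \<longlonglongrightarrow> x + 0 * z"
        by (intro tendsto_intros s)
      then show "(\<lambda>n. v (x + s n * z)) \<longlonglongrightarrow> v x"
        using isCont_tendsto_compose[OF cont[of x]] by simp
    qed
  qed (use bound std_normal_density_integrable in \<open>auto simp: norm_mult intro!: mult_right_mono\<close>)
  moreover have "(LBINT z. std_normal_density z) = 1"
    using integral_std_normal_moment_even[of 0] by simp
  ultimately show ?thesis
    by simp
qed

text \<open>
  The width of the Gaussian mean tends to zero. The weighted integrals of the squared transform then
  increase to the unweighted one, so monotone convergence gives its integrability as well as its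
  value; on the other side the Gaussian average of the continuous bounded function converges to the
  function itself, by dominated convergence.
\<close>
theorem plancherel:
  assumes w: "integrable lborel w" and cont: "continuous_on UNIV w"
    and bound: "\<And>x. cmod (w x) \<le> B"
  shows "integrable lborel (\<lambda>p. (cmod (fourier_transform w p))\<^sup>2)" (is ?int)
    and "(LBINT p. (cmod (fourier_transform w p))\<^sup>2) = 2 * pi * (LBINT x. (cmod (w x))\<^sup>2)" (is ?eq)
proof -
  have [measurable]: "w \<in> borel_measurable borel"
    using borel_measurable_integrable[OF w] by simp
  note [measurable] = borel_measurable_fourier_transform[OF w]
  define s where "s n = inverse (real (Suc n))" for n
  have s: "s n > 0" for n
    by (simp add: s_def)
  have s_lim: "s \<longlonglongrightarrow> 0"
    unfolding s_def by (rule LIMSEQ_inverse_real_of_nat)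
  let ?E = "\<lambda>n p. exp (- (s n * p)\<^sup>2 / 2)"
  let ?F = "\<lambda>n p. ?E n p * (cmod (fourier_transform w p))\<^sup>2"
  let ?J = "\<lambda>n x. LBINT z. cnj (w (x + s n * z)) * of_real (std_normal_density z)"
  have J_bound: "cmod (?J n x) \<le> B" for n x
  proof -
    have "cmod (?J n x) \<le> (LBINT z. B * std_normal_density z)"
    proof (rule Bochner_Integration.integral_norm_bound_integral)
      show "complex_integrable lborel (\<lambda>z. cnj (w (x + s n * z)) * of_real (std_normal_density z))"
        unfolding mult.commute[of "cnj _"]
        by (rule integrable_mult_bounded[where B = B])
           (use bound std_normal_density_integrable in auto)
    qed (use bound std_normal_density_integrable in \<open>auto simp: norm_mult intro!: mult_right_mono\<close>)
    also have "\<dots> = B"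
      using integral_std_normal_moment_even[of 0] by simp
    finally show ?thesis .
  qed
  have J_meas [measurable]: "?J n \<in> borel_measurable lborel" for n
    by (rule lborel.borel_measurable_lebesgue_integral) measurable
  have "(\<lambda>n. LBINT x. w x * ?J n x) \<longlonglongrightarrow> (LBINT x. w x * cnj (w x))"
  proof (rule integral_dominated_convergence[where w = "\<lambda>x. B * cmod (w x)"])
    show "AE x in lborel. (\<lambda>n. w x * ?J n x) \<longlonglongrightarrow> w x * cnj (w x)"
      by (intro AE_I2 tendsto_mult tendsto_const gaussian_mean_tendsto[where B = B] s_lim)
         (use bound cont in \<open>auto intro!: continuous_intros\<close>)
    show "AE x in lborel. cmod (w x * ?J n x) \<le> B * cmod (w x)" for n
      using J_bound by (auto simp only: norm_mult mult.commute[of "cmod (w _)"] intro!: AE_I2 mult_right_mono norm_ge_zero)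
  qed (use w in auto)
  then have J_lim: "(\<lambda>n. 2 * pi * Re (LBINT x. w x * ?J n x)) \<longlonglongrightarrow>
      2 * pi * Re (LBINT x. w x * cnj (w x))"
    by (intro tendsto_intros)
  have "(LBINT x. w x * cnj (w x)) = complex_of_real (LBINT x. (cmod (w x))\<^sup>2)"
    by (simp only: complex_norm_square[symmetric] flip: integral_complex_of_real)
  with J_lim have lim: "(\<lambda>n. 2 * pi * Re (LBINT x. w x * ?J n x)) \<longlonglongrightarrow>
      2 * pi * (LBINT x. (cmod (w x))\<^sup>2)"
    by simp
  have F_int: "integrable lborel (?F n)" for n
  proof (rule Bochner_Integration.integrable_bound)
    show "integrable lborel (\<lambda>p. (LBINT x. cmod (w x))\<^sup>2 * cmod (complex_of_real (?E n p)))"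
      by (intro integrable_mult_right integrable_norm integrable_gaussian s)
    show "AE p in lborel. norm (?F n p) \<le> norm ((LBINT x. cmod (w x))\<^sup>2 * cmod (complex_of_real (?E n p)))"
      by (auto simp: abs_mult intro!: AE_I2 power_mono norm_fourier_transform_le)
  qed simp
  have "complex_of_real (LBINT p. ?F n p) = of_real (2 * pi) * (LBINT x. w x * ?J n x)" for n
  proof -
    have "complex_of_real (LBINT p. ?F n p) = (LBINT p. complex_of_real (?F n p))"
      by (rule integral_complex_of_real[symmetric])
    also have "\<dots> = (LBINT p. of_real (?E n p) * (fourier_transform w p * cnj (fourier_transform w p)))"
      by (simp only: of_real_mult complex_norm_square)
    finally show ?thesis
      using fourier_transform_gaussian_mean[OF w s] by simp
  qed
  from this[THEN arg_cong, of Re] have "(LBINT p. ?F n p) = 2 * pi * Re (LBINT x. w x * ?J n x)" for n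
    by simp
  with lim have ilim: "(\<lambda>n. LBINT p. ?F n p) \<longlonglongrightarrow> 2 * pi * (LBINT x. (cmod (w x))\<^sup>2)"
    by simp
  have mono: "AE p in lborel. mono (\<lambda>n. ?F n p)"
  proof (intro AE_I2 monoI mult_right_mono)
    fix p and m n :: nat
    assume "m \<le> n"
    then have "(s n * \<bar>p\<bar>)\<^sup>2 \<le> (s m * \<bar>p\<bar>)\<^sup>2"
      by (intro power_mono mult_right_mono) (auto simp: s_def field_simps)
    then show "?E m p \<le> ?E n p"
      by (simp add: power_mult_distrib)
  qed simp
  have lim: "AE p in lborel. (\<lambda>n. ?F n p) \<longlonglongrightarrow> (cmod (fourier_transform w p))\<^sup>2"
  proof (rule AE_I2)
    fix p
    have "(\<lambda>n. ?F n p) \<longlonglongrightarrow> exp (- (0 * p)\<^sup>2 / 2) * (cmod (fourier_transform w p))\<^sup>2"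
      by (intro tendsto_intros s_lim) simp
    then show "(\<lambda>n. ?F n p) \<longlonglongrightarrow> (cmod (fourier_transform w p))\<^sup>2"
      by simp
  qed
  show ?int
    by (rule integrable_monotone_convergence[OF F_int mono lim ilim]) simp
  show ?eq
    by (rule integral_monotone_convergence[OF F_int mono lim ilim]) simp
qed

section \<open>Differentiation and the Fourier transform\<close>

lemma continuous_on_fourier_transform:
  assumes w: "integrable lborel w"
  shows "continuous_on UNIV (fourier_transform w)"
proof (rule continuous_on_sequentiallyI)
  fix q :: "nat \<Rightarrow> real" and p
  assume q: "q \<longlonglongrightarrow> p"
  have [measurable]: "w \<in> borel_measurable borel"
    using borel_measurable_integrable[OF w] by simp
  have [measurable]: "(\<lambda>x. exp (- \<i> * of_real (x * p)) :: complex) \<in> borel_measurable lborel" for p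
    by (simp add: borel_measurable_continuous_onI continuous_intros)
  show "(\<lambda>n. fourier_transform w (q n)) \<longlonglongrightarrow> fourier_transform w p"
    unfolding fourier_transform_def
  proof (rule integral_dominated_convergence[where w = "\<lambda>x. cmod (w x)"])
    show "AE x in lborel. (\<lambda>n. w x * exp (- \<i> * of_real (x * q n)))
        \<longlonglongrightarrow> w x * exp (- \<i> * of_real (x * p))"
      by (intro AE_I2 tendsto_intros q)
  qed (use w in \<open>auto simp: norm_mult\<close>)
qed

text \<open>
  Differentiation under the integral sign. The first-order Taylor remainder \<open>R y\<close> of the phase is
  bounded both by \<open>y\<^sup>2 / 2\<close>, which gives pointwise convergence of the difference quotients, and by
  \<open>2 * \<bar>y\<bar>\<close>, which makes the integrable function \<open>2 * \<bar>x * w x\<bar>\<close> a dominating one.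
\<close>
lemma has_vector_derivative_fourier_transform:
  assumes w: "integrable lborel w" and xw: "integrable lborel (\<lambda>x. of_real x * w x)"
  shows "(fourier_transform w has_vector_derivative
      fourier_transform (\<lambda>x. - \<i> * of_real x * w x) p) (at p)"
proof -
  define R where "R y = exp (\<i> * complex_of_real y) - 1 - \<i> * of_real y" for y :: real
  have [measurable]: "w \<in> borel_measurable borel"
    using borel_measurable_integrable[OF w] by simp
  have [measurable]: "R \<in> borel_measurable borel"
    unfolding R_def by (intro borel_measurable_continuous_onI continuous_intros)
  have R1: "cmod (R y) \<le> y\<^sup>2 / 2" for y
    using iexp_approx1[of y 1] by (simp add: R_def algebra_simps power2_eq_square)
  have R2: "cmod (R y) \<le> 2 * \<bar>y\<bar>" for y
    using iexp_approx2[of y 1] by (simp add: R_def algebra_simps)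
  have xw': "integrable lborel (\<lambda>x. - \<i> * of_real x * w x)"
    using integrable_mult_right[OF xw, of "- \<i>"] by (simp add: mult.assoc)
  have remainder: "fourier_transform w (p + h) - fourier_transform w p
      - h *\<^sub>R fourier_transform (\<lambda>x. - \<i> * of_real x * w x) p
      = (LBINT x. w x * exp (- \<i> * of_real (x * p)) * R (- (x * h)))" for h
  proof -
    have "w x * exp (- \<i> * of_real (x * p)) * R (- (x * h)) = w x * exp (- \<i> * of_real (x * (p + h)))
        - w x * exp (- \<i> * of_real (x * p)) - h *\<^sub>R (- \<i> * of_real x * w x * exp (- \<i> * of_real (x * p)))" for x
      by (simp add: R_def scaleR_conv_of_real algebra_simps flip: exp_add)
    then show ?thesis
      unfolding fourier_transform_def
      by (simp only: Bochner_Integration.integral_diff Bochner_Integration.integrable_diff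
          integrable_phase[OF w] integrable_phase[OF xw'] integrable_scaleR_right
          integral_scaleR_right)
  qed
  have "((\<lambda>h. norm (fourier_transform w (p + h) - fourier_transform w p
      - h *\<^sub>R fourier_transform (\<lambda>x. - \<i> * of_real x * w x) p) / norm h) \<longlongrightarrow> 0) (at 0)"
    unfolding tendsto_at_iff_sequentially comp_def
  proof (intro allI impI)
    fix h :: "nat \<Rightarrow> real"
    assume h0: "\<forall>n. h n \<in> UNIV - {0}" and h: "h \<longlonglongrightarrow> 0"
    have h_neq: "h n \<noteq> 0" for n
      using h0 by auto
    have "(\<lambda>n. LBINT x. cmod (w x) * (cmod (R (- (x * h n))) / \<bar>h n\<bar>)) \<longlonglongrightarrow> (LBINT (x::real). 0 :: real)"
    proof (rule integral_dominated_convergence[where w = "\<lambda>x. 2 * cmod (of_real x * w x)"])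
      show "AE x in lborel. (\<lambda>n. cmod (w x) * (cmod (R (- (x * h n))) / \<bar>h n\<bar>)) \<longlonglongrightarrow> 0"
      proof (intro AE_I2 tendsto_mult_right_zero)
        fix x
        have "(\<lambda>n. x\<^sup>2 * \<bar>h n\<bar> / 2) \<longlonglongrightarrow> x\<^sup>2 * \<bar>0\<bar> / 2"
          by (intro tendsto_intros h) simp
        then have lim: "(\<lambda>n. x\<^sup>2 * \<bar>h n\<bar> / 2) \<longlonglongrightarrow> 0"
          by simp
        have "cmod (R (- (x * h n))) / \<bar>h n\<bar> \<le> x\<^sup>2 * \<bar>h n\<bar> / 2" for n
          by (subst pos_divide_le_eq)
             (use R1[of "- (x * h n)"] h_neq[of n] in \<open>simp_all add: power2_eq_square mult_ac\<close>)
        then show "(\<lambda>n. cmod (R (- (x * h n))) / \<bar>h n\<bar>) \<longlonglongrightarrow> 0"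
          by (intro tendsto_sandwich[OF _ _ tendsto_const lim]) auto
      qed
      show "AE x in lborel. norm (cmod (w x) * (cmod (R (- (x * h n))) / \<bar>h n\<bar>))
          \<le> 2 * cmod (of_real x * w x)" for n
      proof (rule AE_I2)
        fix x
        have "cmod (R (- (x * h n))) / \<bar>h n\<bar> \<le> 2 * \<bar>x\<bar>"
          using divide_right_mono[OF R2[of "- (x * h n)"], of "\<bar>h n\<bar>"] h_neq[of n]
          by (simp add: abs_mult)
        from mult_left_mono[OF this norm_ge_zero[of "w x"]]
        show "norm (cmod (w x) * (cmod (R (- (x * h n))) / \<bar>h n\<bar>)) \<le> 2 * cmod (of_real x * w x)"
          by (simp add: norm_mult mult_ac)
      qed
    qed (use xw in \<open>auto intro!: integrable_mult_right integrable_norm\<close>)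
    then have lim: "(\<lambda>n. LBINT x. cmod (w x) * (cmod (R (- (x * h n))) / \<bar>h n\<bar>)) \<longlonglongrightarrow> 0"
      by simp
    have "norm (LBINT x. w x * exp (- \<i> * of_real (x * p)) * R (- (x * h n))) / norm (h n)
        \<le> (LBINT x. cmod (w x) * (cmod (R (- (x * h n))) / \<bar>h n\<bar>))" for n
    proof -
      have "norm (LBINT x. w x * exp (- \<i> * of_real (x * p)) * R (- (x * h n))) / norm (h n)
          \<le> (LBINT x. norm (w x * exp (- \<i> * of_real (x * p)) * R (- (x * h n)))) / norm (h n)"
        by (intro divide_right_mono integral_norm_bound) simp
      then show ?thesis
        by (simp add: norm_mult)
    qed
    then show "(\<lambda>n. norm (fourier_transform w (p + h n) - fourier_transform w p
        - h n *\<^sub>R fourier_transform (\<lambda>x. - \<i> * of_real x * w x) p) / norm (h n)) \<longlonglongrightarrow> 0"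
      unfolding remainder
      by (intro tendsto_sandwich[OF _ _ tendsto_const lim]) auto
  qed
  then show ?thesis
    unfolding has_vector_derivative_def has_derivative_at
    by (simp add: bounded_linear_scaleR_left)
qed

lemma integrable_compact_support:
  fixes v :: "real \<Rightarrow> 'a::{banach, second_countable_topology}"
  assumes "continuous_on UNIV v" and "\<And>p. p \<notin> {a..b} \<Longrightarrow> v p = 0"
  shows "integrable lborel v"
proof -
  have "integrable lborel (\<lambda>x. indicator {a..b} x *\<^sub>R v x)"
    by (rule borel_integrable_compact) (use assms(1) continuous_on_subset in auto)
  also have "(\<lambda>x. indicator {a..b} x *\<^sub>R v x) = v"
    using assms(2) by (auto split: split_indicator)
  finally show ?thesis .
qed

lemma bounded_compact_support:
  fixes v :: "real \<Rightarrow> complex"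
  assumes "continuous_on UNIV v" and zero: "\<And>p. p \<notin> {a..b} \<Longrightarrow> v p = 0"
  obtains B where "\<And>p. cmod (v p) \<le> B"
proof -
  have "bounded (v ` {a..b})"
    by (intro compact_imp_bounded compact_continuous_image continuous_on_subset[OF assms(1)]) auto
  then obtain B where B: "B > 0" "\<And>p. p \<in> {a..b} \<Longrightarrow> cmod (v p) \<le> B"
    unfolding bounded_pos by auto
  have "cmod (v p) \<le> B" for p
    using B zero[of p] by (cases "p \<in> {a..b}") auto
  then show ?thesis
    by (rule that)
qed

lemma vector_derivative_zero_outside:
  fixes G :: "real \<Rightarrow> 'a::real_normed_vector"
  assumes G: "\<And>p. (G has_vector_derivative G' p) (at p)"
    and zero: "\<And>p. p \<notin> {a..b} \<Longrightarrow> G p = 0" and p: "p \<notin> {a..b}"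
  shows "G' p = 0"
proof -
  have "((\<lambda>_. 0) has_vector_derivative G' p) (at p)"
    by (rule has_vector_derivative_transform_within_open[OF G, where S = "- {a..b}"])
       (use zero p in auto)
  then show ?thesis
    using vector_derivative_unique_at[OF _ has_vector_derivative_const] by blast
qed

text \<open>
  Integration by parts. The interval is enlarged by 1 on both sides, to points where the function
  is known to vanish, and the boundary terms disappear.
\<close>
lemma fourier_transform_of_derivative:
  assumes G: "\<And>p. (G has_vector_derivative G' p) (at p)" and cont: "continuous_on UNIV G'"
    and zero: "\<And>p. p \<notin> {a..b} \<Longrightarrow> G p = 0"
  shows "fourier_transform G' q = \<i> * of_real q * fourier_transform G q"
proof -
  have G_cont: "continuous_on UNIV G"
    using G by (meson continuous_at_imp_continuous_on has_vector_derivative_continuous)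
  have zero': "p \<notin> {a..b} \<Longrightarrow> G' p = 0" for p
    using vector_derivative_zero_outside[OF G zero] .
  note G_int = integrable_compact_support[OF G_cont zero]
  note G'_int = integrable_compact_support[OF cont zero']
  let ?e = "\<lambda>p. exp (- \<i> * complex_of_real (p * q))"
  let ?D = "\<lambda>p. G' p * ?e p - \<i> * of_real q * (G p * ?e p)"
  define c d where "c = min a b - 1" and "d = max a b + 1"
  have e: "(?e has_vector_derivative (- \<i> * of_real q) * ?e p) (at p)" for p
  proof -
    have "((\<lambda>z. exp (- \<i> * (z * of_real q))) has_field_derivative (- \<i> * of_real q) * ?e p) (at (of_real p))"
      by (auto intro!: derivative_eq_intros)
    from has_vector_derivative_real_field[OF this] show ?thesis
      by simp
  qed
  have deriv: "((\<lambda>p. G p * ?e p) has_vector_derivative ?D p) (at p)" for p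
    using has_vector_derivative_mult[OF G[of p] e[of p]] by (simp add: algebra_simps)
  have "(LBINT p. indicator {c..d} p *\<^sub>R ?D p) = G d * ?e d - G c * ?e c"
  proof (rule integral_FTC_atLeastAtMost)
    show "continuous_on {c..d} ?D"
      by (intro continuous_intros continuous_on_subset[OF cont] continuous_on_subset[OF G_cont]) auto
  qed (use deriv[THEN has_vector_derivative_at_within] in \<open>auto simp: c_def d_def\<close>)
  moreover have "(\<lambda>p. indicator {c..d} p *\<^sub>R ?D p) = ?D"
  proof
    fix p
    show "indicator {c..d} p *\<^sub>R ?D p = ?D p"
      using zero[of p] zero'[of p] by (cases "p \<in> {a..b}") (auto simp: c_def d_def)
  qed
  moreover have "G c = 0" "G d = 0"
    by (auto intro!: zero simp: c_def d_def)
  ultimately have "(LBINT p. ?D p) = 0"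
    by simp
  then show ?thesis
    unfolding fourier_transform_def
    by (simp only: Bochner_Integration.integral_diff integrable_phase[OF G_int] integrable_phase[OF G'_int]
        integrable_mult_right integral_mult_right_zero) simp
qed

lemma fourier_transform_add:
  assumes "integrable lborel v" "integrable lborel w"
  shows "fourier_transform (\<lambda>x. v x + w x) p = fourier_transform v p + fourier_transform w p"
  unfolding fourier_transform_def distrib_right
  by (intro Bochner_Integration.integral_add integrable_phase assms)

lemma fourier_transform_cmult:
  "fourier_transform (\<lambda>x. c * w x) p = c * fourier_transform w p"
  unfolding fourier_transform_def mult.assoc by (rule integral_mult_right_zero)

text \<open>
  Parseval's identity for the pair \<open>- \<i> G'\<close> and \<open>G\<close>, whose transforms are \<open>q \<cdot> F\<close> and \<open>F\<close> with
  \<open>F = fourier_transform G\<close>. It follows by polarisation from the norm identity for the two functions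
  \<open>- \<i> G' \<plusminus> G\<close>, with transforms \<open>(q \<plusminus> 1) F\<close>, because \<open>(q + 1)\<^sup>2 - (q - 1)\<^sup>2 = 4 q\<close>. Plancherel's
  identity also shows that \<open>(q \<plusminus> 1) F\<close> is square integrable, so that the integrals may be subtracted.
\<close>
lemma first_moment_fourier_transform:
  assumes G: "\<And>p. (G has_vector_derivative G' p) (at p)" and cont: "continuous_on UNIV G'"
    and zero: "\<And>p. p \<notin> {a..b} \<Longrightarrow> G p = 0"
  shows "(LBINT q. q * (cmod (fourier_transform G q))\<^sup>2) = 2 * pi * (LBINT p. Im (G' p * cnj (G p)))"
proof -
  have G_cont: "continuous_on UNIV G"
    using G by (meson continuous_at_imp_continuous_on has_vector_derivative_continuous)
  have zero': "p \<notin> {a..b} \<Longrightarrow> G' p = 0" for p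
    using vector_derivative_zero_outside[OF G zero] .
  note G_int = integrable_compact_support[OF G_cont zero]
  note G'_int = integrable_compact_support[OF cont zero']
  \<comment> \<open>Used only for \<open>c = 1\<close> and \<open>c = - 1\<close>, the two functions of the polarisation.\<close>
  define w where "w c p = - \<i> * G' p + of_real c * G p" for c :: real and p
  have w_cont: "continuous_on UNIV (w c)" for c
    unfolding w_def by (intro continuous_intros cont G_cont)
  have w_zero: "w c p = 0" if "p \<notin> {a..b}" for c p
    using zero[OF that] zero'[OF that] by (simp add: w_def)
  have w_int: "integrable lborel (w c)" for c
    by (rule integrable_compact_support[OF w_cont w_zero])
  have ft_w: "fourier_transform (w c) q = of_real (q + c) * fourier_transform G q" for c q
  proof -
    have "fourier_transform (w c) q = - \<i> * fourier_transform G' q + of_real c * fourier_transform G q"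
      unfolding w_def by (simp only: fourier_transform_add fourier_transform_cmult integrable_mult_right G_int G'_int)
    also have "fourier_transform G' q = \<i> * of_real q * fourier_transform G q"
      by (rule fourier_transform_of_derivative[OF G cont zero])
    finally show ?thesis
      by (simp add: algebra_simps)
  qed
  have norm_ft_w: "(cmod (fourier_transform (w c) q))\<^sup>2 = (q + c)\<^sup>2 * (cmod (fourier_transform G q))\<^sup>2" for c q
    unfolding ft_w by (simp add: norm_mult power_mult_distrib flip: of_real_add)
  have pl: "integrable lborel (\<lambda>q. (cmod (fourier_transform (w c) q))\<^sup>2)"
    "(LBINT q. (cmod (fourier_transform (w c) q))\<^sup>2) = 2 * pi * (LBINT p. (cmod (w c p))\<^sup>2)" for c
  proof -
    obtain B where "\<And>p. cmod (w c p) \<le> B"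
      using bounded_compact_support[OF w_cont w_zero] by blast
    then show "integrable lborel (\<lambda>q. (cmod (fourier_transform (w c) q))\<^sup>2)"
      "(LBINT q. (cmod (fourier_transform (w c) q))\<^sup>2) = 2 * pi * (LBINT p. (cmod (w c p))\<^sup>2)"
      using plancherel[OF w_int w_cont] by blast+
  qed
  have w2_int: "integrable lborel (\<lambda>p. (cmod (w c p))\<^sup>2)" for c
    by (rule integrable_compact_support[where a = a and b = b])
       (use w_zero in \<open>auto intro!: continuous_intros w_cont\<close>)
  have "(LBINT q. q * (cmod (fourier_transform G q))\<^sup>2)
      = (LBINT q. ((cmod (fourier_transform (w 1) q))\<^sup>2 - (cmod (fourier_transform (w (- 1)) q))\<^sup>2) / 4)"
    unfolding norm_ft_w by (rule Bochner_Integration.integral_cong) (auto simp: power2_eq_square algebra_simps)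
  also have "\<dots> = 2 * pi * (LBINT p. ((cmod (w 1 p))\<^sup>2 - (cmod (w (- 1) p))\<^sup>2) / 4)"
    using pl w2_int by (simp add: field_simps)
  also have "(\<lambda>p. ((cmod (w 1 p))\<^sup>2 - (cmod (w (- 1) p))\<^sup>2) / 4) = (\<lambda>p. Im (G' p * cnj (G p)))"
    unfolding w_def cmod_power2 by (rule ext) (simp add: power2_eq_square field_simps)
  finally show ?thesis .
qed

section \<open>The mean position of the wave packet\<close>

text \<open>
  At time \<open>t\<close> the packet is the inverse transform of \<open>G = g \<cdot> exp (- \<i> t f)\<close>, where \<open>g\<close> is the transform
  of the initial state. The phase has modulus 1, so in \<open>Im (G' \<cdot> cnj G)\<close> it survives only through its
  logarithmic derivative \<open>- \<i> t f'\<close>. Hence the mean position is an affine function of time.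
\<close>
lemma mean_position_wave_packet:
  assumes g: "\<And>p. (fourier_transform u0 has_vector_derivative g' p) (at p)"
    and g'_cont: "continuous_on UNIV g'"
    and zero: "\<And>p. p \<notin> {a..b} \<Longrightarrow> fourier_transform u0 p = 0"
    and f: "\<And>p. (f has_real_derivative f' p) (at p)" and f'_cont: "continuous_on UNIV f'"
  shows "mean_position (wave_packet f u0 t) =
    (t * (LBINT p. f' p * (cmod (fourier_transform u0 p))\<^sup>2)
      - (LBINT p. Im (g' p * cnj (fourier_transform u0 p)))) / (2 * pi)"
proof -
  let ?g = "fourier_transform u0"
  define e where "e p = exp (- \<i> * complex_of_real (t * f p))" for p
  define G where "G p = ?g p * e p" for p
  define G' where "G' p = (g' p - \<i> * of_real (t * f' p) * ?g p) * e p" for p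
  have f_cont: "continuous_on UNIV f"
    using f by (meson DERIV_isCont continuous_at_imp_continuous_on)
  have g_cont: "continuous_on UNIV ?g"
    using g by (meson continuous_at_imp_continuous_on has_vector_derivative_continuous)
  have e: "(e has_vector_derivative - \<i> * of_real (t * f' p) * e p) (at p)" for p
  proof -
    have inner: "((\<lambda>p. complex_of_real (t * f p)) has_vector_derivative of_real (t * f' p)) (at p)"
      by (intro has_vector_derivative_of_real)
         (auto intro!: derivative_eq_intros f simp flip: has_real_derivative_iff_has_vector_derivative)
    have outer: "((\<lambda>z. exp (- \<i> * z)) has_field_derivative - \<i> * exp (- \<i> * z)) (at z)" for z
      by (auto intro!: derivative_eq_intros)
    show ?thesis
      using field_vector_diff_chain_at[OF inner outer] unfolding e_def comp_def
      by (simp add: mult_ac)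
  qed
  have G: "(G has_vector_derivative G' p) (at p)" for p
    using has_vector_derivative_mult[OF g[of p] e[of p]] unfolding G_def G'_def
    by (simp add: algebra_simps)
  have G'_cont: "continuous_on UNIV G'"
    unfolding G'_def e_def by (intro continuous_intros g'_cont f'_cont f_cont g_cont)
  have G_zero: "G p = 0" if "p \<notin> {a..b}" for p
    using zero[OF that] by (simp add: G_def)
  \<comment> \<open>The packet is a forward transform at \<open>- x\<close>, which is why the sign of the first moment flips
    below.\<close>
  have packet: "wave_packet f u0 t x = of_real (1 / (2 * pi)) * fourier_transform G (- x)" for x
    unfolding wave_packet_def fourier_transform_def[of G] G_def e_def
    by (simp add: mult.assoc mult.commute[of "complex_of_real x"] flip: exp_add)
  have "mean_position (wave_packet f u0 t)
      = (LBINT x. x * (cmod (fourier_transform G (- x)))\<^sup>2 / (2 * pi)\<^sup>2)"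
    unfolding mean_position_def packet by (simp add: norm_mult norm_divide power_mult_distrib power_divide)
  also have "\<dots> = (LBINT x. x * (cmod (fourier_transform G (- x)))\<^sup>2) / (2 * pi)\<^sup>2"
    by (rule integral_divide_zero)
  also have "(LBINT x. x * (cmod (fourier_transform G (- x)))\<^sup>2) = - (LBINT q. q * (cmod (fourier_transform G q))\<^sup>2)"
    by (subst lborel_integral_real_affine[of "-1" _ 0]) auto
  also have "(LBINT q. q * (cmod (fourier_transform G q))\<^sup>2) = 2 * pi * (LBINT p. Im (G' p * cnj (G p)))"
    by (rule first_moment_fourier_transform[OF G G'_cont G_zero])
  also have "(\<lambda>p. Im (G' p * cnj (G p))) = (\<lambda>p. Im (g' p * cnj (?g p)) - t * (f' p * (cmod (?g p))\<^sup>2))"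
  proof
    fix p
    have "cmod (e p) = 1"
      unfolding e_def by simp
    then have "e p * cnj (e p) = 1"
      by (metis complex_norm_square of_real_1 power_one)
    then have "G' p * cnj (G p) = (g' p - \<i> * of_real (t * f' p) * ?g p) * cnj (?g p)"
      unfolding G_def G'_def by (simp add: mult_ac)
    also have "\<dots> = g' p * cnj (?g p) - \<i> * of_real (t * f' p * (cmod (?g p))\<^sup>2)"
      using complex_norm_square[of "?g p"] by (simp add: algebra_simps)
    finally show "Im (G' p * cnj (G p)) = Im (g' p * cnj (?g p)) - t * (f' p * (cmod (?g p))\<^sup>2)"
      by simp
  qed
  also have "(LBINT p. Im (g' p * cnj (?g p)) - t * (f' p * (cmod (?g p))\<^sup>2))
      = (LBINT p. Im (g' p * cnj (?g p))) - t * (LBINT p. f' p * (cmod (?g p))\<^sup>2)"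
  proof (subst Bochner_Integration.integral_diff)
    show "integrable lborel (\<lambda>p. Im (g' p * cnj (?g p)))"
      by (rule integrable_compact_support[where a = a and b = b])
         (use zero in \<open>auto intro!: continuous_intros g'_cont g_cont\<close>)
    show "integrable lborel (\<lambda>p. t * (f' p * (cmod (?g p))\<^sup>2))"
      by (rule integrable_compact_support[where a = a and b = b])
         (use zero in \<open>auto intro!: continuous_intros f'_cont g_cont\<close>)
  qed simp
  also have "- (2 * pi * (A - t * B)) / (2 * pi)\<^sup>2 = (t * B - A) / (2 * pi)" for A B
    by (simp add: field_simps power2_eq_square)
  finally show ?thesis .
qed

section \<open>The mean position of the asymptotic profile\<close>

text \<open>
  Every point of the cone is written as \<open>x0 + (t - t0) * deriv f p\<close>; then \<open>p\<close> is the stationary point.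
\<close>
lemma norm_H_profile_squared:
  assumes "t \<noteq> t0" and pos: "deriv (deriv f) p > 0" and inj: "inj (deriv f)"
  shows "(cmod (H_profile f t (x0 + (t - t0) * deriv f p) u0 t0 x0))\<^sup>2
    = (cmod (fourier_transform u0 p))\<^sup>2 / (2 * pi * \<bar>t - t0\<bar> * deriv (deriv f) p)"
proof -
  have quot: "(x0 + (t - t0) * deriv f p - x0) / (t - t0) = deriv f p"
    using assms(1) by simp
  have stat: "stationary_point f t0 x0 t (x0 + (t - t0) * deriv f p) = p"
    unfolding stationary_point_def quot by (rule inv_f_f[OF inj])
  have "cmod (H_profile f t (x0 + (t - t0) * deriv f p) u0 t0 x0)
      = 1 / sqrt (2 * pi) * (cmod (fourier_transform u0 p) / sqrt (deriv (deriv f) p)) * \<bar>t - t0\<bar> powr (- (1 / 2))"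
    unfolding H_profile_def quot stat using pos
    by (simp add: norm_mult norm_divide norm_exp_eq_Re)
  moreover have "(\<bar>t - t0\<bar> powr (- (1 / 2)))\<^sup>2 = 1 / \<bar>t - t0\<bar>"
    using assms(1) by (simp add: power2_eq_square powr_minus_divide flip: powr_add)
  ultimately show ?thesis
    using pos by (simp add: power_mult_distrib power_divide)
qed

text \<open>
  The change of variables \<open>x = x0 + (t - t0) * deriv f p\<close> carries the density of the profile to
  \<open>\<bar>g p\<bar>\<^sup>2 / (2 \<pi>)\<close>, where \<open>g\<close> is the transform of the initial state: the
  factors \<open>\<bar>t - t0\<bar>\<close> and \<open>deriv (deriv f) p\<close> of the Jacobian cancel those of the profile. It is done in
  two steps, an affine one and the substitution \<open>y = deriv f p\<close>.
\<close>
lemma mean_position_H_profile: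
  assumes t: "t \<noteq> t0" and "a \<le> b"
    and f': "\<And>p. (deriv f has_real_derivative deriv (deriv f) p) (at p)"
    and f''_cont: "continuous_on UNIV (deriv (deriv f))" and pos: "\<And>p. deriv (deriv f) p > 0"
    and g_cont: "continuous_on UNIV (fourier_transform u0)"
    and zero: "\<And>p. p \<notin> {a..b} \<Longrightarrow> fourier_transform u0 p = 0"
  shows "mean_position (\<lambda>x. H_profile f t x u0 t0 x0) =
    (x0 * (LBINT p. (cmod (fourier_transform u0 p))\<^sup>2)
      + (t - t0) * (LBINT p. deriv f p * (cmod (fourier_transform u0 p))\<^sup>2)) / (2 * pi)"
proof -
  let ?g = "fourier_transform u0"
  let ?f' = "deriv f" and ?f'' = "deriv (deriv f)"
  have mono: "strict_mono ?f'"
    by (rule strict_monoI) (use DERIV_pos_imp_increasing f' pos in blast)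
  then have inj: "inj ?f'"
    by (rule strict_mono_imp_inj_on)
  have f'_cont: "continuous_on UNIV ?f'"
    using f' by (meson DERIV_isCont continuous_at_imp_continuous_on)
  define \<psi> where "\<psi> p = (x0 + (t - t0) * ?f' p) * (cmod (?g p))\<^sup>2 / (2 * pi * ?f'' p)" for p
  define \<phi> where "\<phi> y = \<psi> (inv ?f' y)" for y
  have \<phi>_f': "\<phi> (?f' p) = \<psi> p" for p
    unfolding \<phi>_def inv_f_f[OF inj] ..
  have \<psi>_zero: "\<psi> p = 0" if "p \<notin> {a..b}" for p
    using zero[OF that] by (simp add: \<psi>_def)
  have image: "?f' ` {a..b} = {?f' a..?f' b}"
  proof (intro subset_antisym subsetI)
    fix y assume "y \<in> {?f' a..?f' b}"
    then show "y \<in> ?f' ` {a..b}"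
      using IVT'[of ?f' a y b] \<open>a \<le> b\<close> continuous_on_subset[OF f'_cont] by auto
  qed (use mono in \<open>auto simp: strict_mono_less_eq\<close>)
  \<comment> \<open>Outside the range of the derivative the profile is zero by convention, and over the rest of that
    range it is zero because the transform vanishes outside \<open>{a..b}\<close>. So the integrand lives on the
    image of the compact interval, where the substitution rule applies.\<close>
  have integrand: "\<bar>t - t0\<bar> * ((x0 + (t - t0) * y) * (cmod (H_profile f t (x0 + (t - t0) * y) u0 t0 x0))\<^sup>2)
      = \<phi> y * indicator {?f' a..?f' b} y" for y
  proof (cases "y \<in> range ?f'")
    case True
    then obtain p where y: "y = ?f' p"
      by blast
    have "p \<in> {a..b} \<longleftrightarrow> y \<in> {?f' a..?f' b}"
      unfolding y using mono by (simp add: strict_mono_less_eq)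
    then have "\<phi> y * indicator {?f' a..?f' b} y = \<psi> p"
      using \<psi>_zero[of p] by (auto simp: y \<phi>_f' split: split_indicator)
    then show ?thesis
      using t pos[of p] unfolding y norm_H_profile_squared[OF t pos inj] \<psi>_def by simp
  next
    case False
    then have "H_profile f t (x0 + (t - t0) * y) u0 t0 x0 = 0"
      using t by (simp add: H_profile_def)
    moreover have "y \<notin> {?f' a..?f' b}"
      using False image by blast
    ultimately show ?thesis
      by simp
  qed
  have "continuous_on (?f' ` {a..b}) (inv ?f')"
    by (rule continuous_on_inv)
       (use inj f'_cont continuous_on_subset in \<open>auto simp: inv_f_f\<close>)
  moreover have "continuous_on UNIV \<psi>"
    unfolding \<psi>_def using pos by (intro continuous_intros f'_cont f''_cont g_cont) (auto simp: less_imp_neq[symmetric])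
  ultimately have "continuous_on {?f' a..?f' b} \<phi>"
    unfolding \<phi>_def image by (auto intro: continuous_on_compose2)
  then have \<phi>_int: "set_integrable lborel {?f' a..?f' b} \<phi>"
    by (rule borel_integrable_atLeastAtMost')
  have "mean_position (\<lambda>x. H_profile f t x u0 t0 x0)
      = \<bar>t - t0\<bar> * (LBINT y. (x0 + (t - t0) * y) * (cmod (H_profile f t (x0 + (t - t0) * y) u0 t0 x0))\<^sup>2)"
    unfolding mean_position_def
    by (subst lborel_integral_real_affine[of "t - t0" _ x0]) (use t in auto)
  also have "\<dots> = (LBINT y. \<phi> y * indicator {?f' a..?f' b} y)"
    unfolding integrand[symmetric] by (rule integral_mult_right_zero[symmetric])
  also have "\<dots> = (LBINT p. \<phi> (?f' p) * ?f'' p * indicator {a..b} p)"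
    by (rule integral_substitution(2)[OF \<phi>_int f' _ less_imp_le[OF pos] \<open>a \<le> b\<close>])
       (rule continuous_on_subset[OF f''_cont], simp)
  also have "(\<lambda>p. \<phi> (?f' p) * ?f'' p * indicator {a..b} p)
      = (\<lambda>p. (x0 * (cmod (?g p))\<^sup>2 + (t - t0) * (?f' p * (cmod (?g p))\<^sup>2)) / (2 * pi))"
  proof
    fix p
    have "\<phi> (?f' p) * ?f'' p * indicator {a..b} p = \<psi> p * ?f'' p"
      using \<psi>_zero[of p] by (auto simp: \<phi>_f' split: split_indicator)
    also have "\<dots> = (x0 * (cmod (?g p))\<^sup>2 + (t - t0) * (?f' p * (cmod (?g p))\<^sup>2)) / (2 * pi)"
      using pos[of p] by (simp add: \<psi>_def field_simps)
    finally show "\<phi> (?f' p) * ?f'' p * indicator {a..b} p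
        = (x0 * (cmod (?g p))\<^sup>2 + (t - t0) * (?f' p * (cmod (?g p))\<^sup>2)) / (2 * pi)" .
  qed
  also have "(LBINT p. (x0 * (cmod (?g p))\<^sup>2 + (t - t0) * (?f' p * (cmod (?g p))\<^sup>2)) / (2 * pi))
      = (x0 * (LBINT p. (cmod (?g p))\<^sup>2) + (t - t0) * (LBINT p. ?f' p * (cmod (?g p))\<^sup>2)) / (2 * pi)"
  proof -
    have "integrable lborel (\<lambda>p. (cmod (?g p))\<^sup>2)"
      by (rule integrable_compact_support[where a = a and b = b])
         (use zero in \<open>auto intro!: continuous_intros g_cont\<close>)
    moreover have "integrable lborel (\<lambda>p. ?f' p * (cmod (?g p))\<^sup>2)"
      by (rule integrable_compact_support[where a = a and b = b])
         (use zero in \<open>auto intro!: continuous_intros f'_cont g_cont\<close>)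
    ultimately show ?thesis
      by simp
  qed
  finally show ?thesis .
qed

section \<open>Schwartz functions and smooth symbols\<close>

lemma integrable_quadratic_decay:
  fixes v :: "real \<Rightarrow> complex"
  assumes "continuous_on UNIV v" and bound: "\<And>x. cmod (v x) * (1 + x\<^sup>2) \<le> C"
  shows "integrable lborel v"
proof (rule Bochner_Integration.integrable_bound)
  show "integrable lborel (\<lambda>x::real. C * inverse (1 + x\<^sup>2))"
    using integrable_inverse_1_plus_square by (simp add: set_integrable_def)
  show "v \<in> borel_measurable lborel"
    using borel_measurable_continuous_onI[OF assms(1)] by simp
  have "cmod (v x) \<le> norm (C * inverse (1 + x\<^sup>2))" for x
  proof -
    have *: "1 + x\<^sup>2 > 0"
      by (simp add: add_pos_nonneg)
    have "cmod (v x) \<le> C * inverse (1 + x\<^sup>2)"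
      using bound[of x] pos_le_divide_eq[OF *] by (simp add: divide_inverse)
    also have "\<dots> \<le> norm (C * inverse (1 + x\<^sup>2))"
      by simp
    finally show ?thesis .
  qed
  then show "AE x in lborel. cmod (v x) \<le> norm (C * inverse (1 + x\<^sup>2))"
    by simp
qed

lemma smooth_imp_differentiable:
  assumes "smooth v"
  shows "higher_vderiv n v differentiable (at x)"
  using assms unfolding smooth_def by blast

lemma schwartz_continuous:
  assumes "schwartz u"
  shows "continuous_on UNIV u"
  using assms smooth_imp_differentiable[of u 0] unfolding schwartz_def
  by (auto intro!: continuous_at_imp_continuous_on differentiable_imp_continuous_within)

lemma schwartz_bounded:
  assumes "schwartz u"
  obtains C where "\<And>x. cmod (of_real (x ^ m) * u x) \<le> C"
proof -
  have "bounded (range (\<lambda>x. of_real (x ^ m) * higher_vderiv 0 u x))"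
    using assms unfolding schwartz_def by blast
  then show ?thesis
    using that unfolding bounded_iff by auto
qed

lemma schwartz_integrable:
  assumes u: "schwartz u"
  shows "integrable lborel (\<lambda>x. of_real (x ^ m) * u x)"
proof -
  obtain C where C: "\<And>x. cmod (of_real (x ^ m) * u x) \<le> C"
    using schwartz_bounded[OF u] by blast
  obtain D where D: "\<And>x. cmod (of_real (x ^ (m + 2)) * u x) \<le> D"
    using schwartz_bounded[OF u] by blast
  show ?thesis
  proof (rule integrable_quadratic_decay)
    show "continuous_on UNIV (\<lambda>x. of_real (x ^ m) * u x)"
      by (intro continuous_intros schwartz_continuous[OF u])
    show "cmod (of_real (x ^ m) * u x) * (1 + x\<^sup>2) \<le> C + D" for x
    proof -
      have "cmod (of_real (x ^ (m + 2)) * u x) = cmod (of_real (x ^ m) * u x) * x\<^sup>2"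
        by (simp add: norm_mult norm_power power_add mult_ac del: add_2_eq_Suc')
      then show ?thesis
        using add_mono[OF C[of x] D[of x]] by (simp add: distrib_left)
    qed
  qed
qed

lemma smooth_deriv:
  fixes f :: "real \<Rightarrow> real"
  assumes "smooth f"
  shows "(f has_real_derivative deriv f p) (at p)"
    and "(deriv f has_real_derivative deriv (deriv f) p) (at p)"
    and "continuous_on UNIV (deriv (deriv f))"
proof -
  have D: "higher_vderiv 1 f = deriv f" "higher_vderiv 2 f = deriv (deriv f)"
    by (simp_all add: numeral_2_eq_2 field_derivative_eq_vector_derivative[abs_def])
  show "(f has_real_derivative deriv f p) (at p)"
    using smooth_imp_differentiable[OF assms, of 0 p] by (simp add: DERIV_deriv_iff_real_differentiable)
  show "(deriv f has_real_derivative deriv (deriv f) p) (at p)"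
    using smooth_imp_differentiable[OF assms, of 1 p] unfolding D
    by (simp add: DERIV_deriv_iff_real_differentiable)
  show "continuous_on UNIV (deriv (deriv f))"
    using smooth_imp_differentiable[OF assms, of 2] unfolding D
    by (auto intro!: continuous_at_imp_continuous_on differentiable_imp_continuous_within)
qed

section \<open>Comparison of the mean positions\<close>

theorem proposition4p2:
  fixes p1 p2 t0 x0 :: real
    and f :: "real \<Rightarrow> real"
    and u0 :: "real \<Rightarrow> complex"
  assumes "p1 < p2"
    and "is_symbol f"
    and "\<forall>p. deriv (deriv f) p > 0"
    and "schwartz u0"
    and "support (fourier_transform u0) \<subseteq> {p1..p2}"
    and "L2_norm u0 = 1"
  shows "\<forall>t. t \<noteq> t0 \<longrightarrow>
    (mean_position (\<lambda>x. wave_packet f u0 t x) =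
       mean_position (\<lambda>x. H_profile f t x u0 t0 x0)
     \<longleftrightarrow> x0 = mean_position (\<lambda>x. wave_packet f u0 t0 x))"
proof (intro allI impI)
  fix t assume t: "t \<noteq> t0"
  let ?g = "fourier_transform u0"
  let ?g' = "fourier_transform (\<lambda>x. - \<i> * of_real x * u0 x)"
  note u0 = \<open>schwartz u0\<close>
  have u0_int: "integrable lborel u0"
    using schwartz_integrable[OF u0, of 0] by simp
  have xu0_int: "integrable lborel (\<lambda>x. of_real x * u0 x)"
    using schwartz_integrable[OF u0, of 1] by simp
  have g: "(?g has_vector_derivative ?g' p) (at p)" for p
    by (rule has_vector_derivative_fourier_transform[OF u0_int xu0_int])
  have g'_cont: "continuous_on UNIV ?g'"
    by (rule continuous_on_fourier_transform)
       (use integrable_mult_right[OF xu0_int, of "- \<i>"] in \<open>simp add: mult.assoc\<close>)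
  have g_cont: "continuous_on UNIV ?g"
    by (rule continuous_on_fourier_transform[OF u0_int])
  have zero: "?g p = 0" if "p \<notin> {p1..p2}" for p
    using that \<open>support ?g \<subseteq> {p1..p2}\<close> closure_subset[of "{p. ?g p \<noteq> 0}"]
    unfolding support_def by blast
  have "smooth f"
    using \<open>is_symbol f\<close> by (simp add: is_symbol_def)
  note f = smooth_deriv[OF this]
  have f'_cont: "continuous_on UNIV (deriv f)"
    using f(2) by (meson DERIV_isCont continuous_at_imp_continuous_on)
  have pos: "deriv (deriv f) p > 0" for p
    using assms(3) by blast
  obtain B where "\<And>x. cmod (u0 x) \<le> B"
    using schwartz_bounded[OF u0, of 0] by auto
  from plancherel(2)[OF u0_int schwartz_continuous[OF u0] this]
  have norm_g: "(LBINT p. (cmod (?g p))\<^sup>2) = 2 * pi"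
    using \<open>L2_norm u0 = 1\<close> by (simp add: L2_norm_def)
  define V where "V = (LBINT p. deriv f p * (cmod (?g p))\<^sup>2) / (2 * pi)"
  define X where "X = - (LBINT p. Im (?g' p * cnj (?g p))) / (2 * pi)"
  have packet: "mean_position (\<lambda>x. wave_packet f u0 s x) = X + s * V" for s
  proof -
    have "mean_position (\<lambda>x. wave_packet f u0 s x) = (s * (LBINT p. deriv f p * (cmod (?g p))\<^sup>2)
        - (LBINT p. Im (?g' p * cnj (?g p)))) / (2 * pi)"
      by (rule mean_position_wave_packet[OF g g'_cont zero f(1) f'_cont])
    then show ?thesis
      unfolding X_def V_def by (simp add: diff_divide_distrib)
  qed
  have "mean_position (\<lambda>x. H_profile f t x u0 t0 x0) = x0 + (t - t0) * V"
  proof -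
    have "mean_position (\<lambda>x. H_profile f t x u0 t0 x0) = (x0 * (LBINT p. (cmod (?g p))\<^sup>2)
        + (t - t0) * (LBINT p. deriv f p * (cmod (?g p))\<^sup>2)) / (2 * pi)"
      by (rule mean_position_H_profile[OF t less_imp_le[OF \<open>p1 < p2\<close>] f(2,3) pos g_cont zero])
    then show ?thesis
      unfolding norm_g V_def by (simp add: add_divide_distrib)
  qed
  then show "(mean_position (\<lambda>x. wave_packet f u0 t x) = mean_position (\<lambda>x. H_profile f t x u0 t0 x0))
      \<longleftrightarrow> (x0 = mean_position (\<lambda>x. wave_packet f u0 t0 x))"
    unfolding packet by (auto simp: algebra_simps)
qed

end
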